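(* Let $\mathcal F:\mathbb{GA}_N\to\mathbb{G\overline A}_N$ be a mapping defined on a non-symmetric affine connection space $\mathbb{GA}_N$ which transforms the affine connection coefficients by the rule $$\overline L{}^i_{jk}=L^i_{jk}+s_1\big[\delta^i_j(\overline u_k-u_k)+\delta^i_k(\overline u_j-u_j)\big]+s_2\big[(\overline f{}^i_j\overline\sigma_k+\overline f{}^i_k\overline\sigma_j)-(f^i_j\sigma_k+f^i_k\sigma_j)\big]+s_3\big[\overline\phi{}^i_{jk}-\phi^i_{jk}\big]+\xi^i_{jk},$$ where $s_1,s_2,s_3\in\{0,1\}$, $\xi^i_{jk}=-\xi^i_{kj}$ is a tensor of type $(1,2)$, $u_j,\overline u_j,\sigma_j,\overline\sigma_j$ are covariant vectors, $f^i_j,\overline f{}^i_j$ are affinors, and $\phi^i_{jk}=\phi^i_{kj}$, $\overline\phi{}^i_{jk}=\overline\phi{}^i_{kj}$ are geometrical objects of type $(1,2)$. Then the geometrical object $$\widetilde{\mathcal T}{}^i_{jk}=L^i_{\underline{jk}}-s_2\big(f^i_j\sigma_k+f^i_k\sigma_j\big)-s_3\phi^i_{jk}-\frac1{N+1}\Big\{\delta^i_j\big[L^\alpha_{\underline{k\alpha}}-s_2(f^\alpha_k\sigma_\alpha+f\sigma_k)-s_3\phi^\alpha_{k\alpha}\big]+\delta^i_k\big[L^\alpha_{\underline{j\alpha}}-s_2(f^\alpha_j\sigma_\alpha+f\sigma_j)-s_3\phi^\alpha_{j\alpha}\big]\Big\},$$ with $f=f^\alpha_\alpha$, is the basic associated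 invariant of the Thomas type for $\mathcal F$; in particular $\widetilde{\overline{\mathcal T}}{}^i_{jk}=\widetilde{\mathcal T}{}^i_{jk}$.
   Context: A non-symmetric affine connection space $\mathbb{GA}_N$ is an $N$-dimensional manifold with an affine connection with torsion, with coefficients $L^i_{jk}$ (in general $L^i_{jk}\neq L^i_{kj}$). Put $L^i_{\underline{jk}}=\frac12(L^i_{jk}+L^i_{kj})$. Summation over repeated Greek indices is understood. An affinor is a tensor of type $(1,1)$. A mapping $\mathcal F:\mathbb{GA}_N\to\mathbb{G\overline A}_N$ is considered in coordinates common to both spaces with respect to $\mathcal F$. Barred symbols denote the corresponding objects of $\mathbb{G\overline A}_N$. A geometrical object built from unbarred data is an invariant for $\mathcal F$ if it equals the object built by the same formula from the barred data; $\widetilde{\overline{\mathcal T}}{}^i_{jk}$ denotes the object built from $\overline L,\overline f,\overline\sigma,\overline\phi$ by the formula for $\widetilde{\mathcal T}{}^i_{jk}$. If the symmetric part of the deformation tensor is written as $\overline L{}^i_{\underline{jk}}-L^i_{\underline{jk}}=\overline\omega{}^i_{jk}-\omega^i_{jk}$, the basic associated invariant of the Thomas type is $L^i_{\underline{jk}}-\omega^i_{jk}$. Here the object used is $$\omega^i_{jk}=s_2(f^i_j\sigma_k+f^i_k\sigma_j)+s_3\phi^i_{jk}+\frac1{N+1}\delta^i_j\big[L^\alpha_{\underline{k\alpha}}-s_2(f^\alpha_k\sigma_\alpha+f\sigma_k)-s_3\phi^\alpha_{k\alpha}\big]+\frac1{N+1}\delta^i_k\big[L^\alpha_{\underline{j\alpha}}-s_2(f^\alpha_j\sigma_\alpha+f\sigma_j)-s_3\phi^\alpha_{j\alpha}\big].$$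 *)

theory Defs
  imports "HOL-Analysis.Analysis"
begin

section \<open>Smooth manifolds modelled on \<open>real ^ 'n\<close>\<close>

definition partial_deriv :: "(real ^ 'n \<Rightarrow> 'b::real_normed_vector) \<Rightarrow> 'n::finite \<Rightarrow> real ^ 'n \<Rightarrow> 'b"
  where "partial_deriv g j x = frechet_derivative g (at x) (axis j 1)"

text \<open>\<open>Ck_on k S g\<close> says that \<open>g\<close> is of class \<open>C^k\<close> on \<open>S\<close>; it is only used for open \<open>S\<close>.\<close>

primrec Ck_on :: "nat \<Rightarrow> (real ^ 'n::finite) set \<Rightarrow> (real ^ 'n \<Rightarrow> 'b::real_normed_vector) \<Rightarrow> bool"
  where
    "Ck_on 0 S g \<longleftrightarrow> continuous_on S g"
  | "Ck_on (Suc k) S g \<longleftrightarrow>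
       (\<forall>x\<in>S. g differentiable (at x)) \<and> (\<forall>j. Ck_on k S (partial_deriv g j))"

definition smooth_on :: "(real ^ 'n::finite) set \<Rightarrow> (real ^ 'n \<Rightarrow> 'b::real_normed_vector) \<Rightarrow> bool"
  where "smooth_on S g \<longleftrightarrow> (\<forall>k. Ck_on k S g)"

text \<open>A chart is a pair of a domain and a coordinate map.  The coordinate map is required to be
  extensional, so that a chart is determined by its domain and its values there.\<close>

type_synonym ('a, 'n) chart = "'a set \<times> ('a \<Rightarrow> real ^ 'n)"

definition is_chart :: "'a topology \<Rightarrow> ('a, 'n::finite) chart \<Rightarrow> bool"
  where "is_chart X c \<longleftrightarrow>
    openin X (fst c) \<and> open (snd c ` fst c) \<and> snd c \<in> extensional (fst c) \<and>
    homeomorphic_map (subtopology X (fst c)) (top_of_set (snd c ` fst c)) (snd c)"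

definition transition :: "('a, 'n::finite) chart \<Rightarrow> ('a, 'n) chart \<Rightarrow> real ^ 'n \<Rightarrow> real ^ 'n"
  where "transition c d x = snd d (inv_into (fst c) (snd c) x)"

definition compatible_charts :: "('a, 'n::finite) chart \<Rightarrow> ('a, 'n) chart \<Rightarrow> bool"
  where "compatible_charts c d \<longleftrightarrow>
    smooth_on (snd c ` (fst c \<inter> fst d)) (transition c d) \<and>
    smooth_on (snd d ` (fst c \<inter> fst d)) (transition d c)"

text \<open>Atlases are maximal, so all admissible coordinate systems are available; the dimension
  is \<open>CARD('n)\<close>.\<close>

definition smooth_manifold :: "'a topology \<Rightarrow> ('a, 'n::finite) chart set \<Rightarrow> bool"
  where "smooth_manifold X A \<longleftrightarrow>
    Hausdorff_space X \<and> second_countable X \<and>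
    (\<forall>c\<in>A. is_chart X c) \<and> (\<Union>c\<in>A. fst c) = topspace X \<and>
    (\<forall>c\<in>A. \<forall>d\<in>A. compatible_charts c d) \<and>
    (\<forall>c. is_chart X c \<and> (\<forall>d\<in>A. compatible_charts c d) \<longrightarrow> c \<in> A)"

definition smooth_map ::
  "('a, 'n::finite) chart set \<Rightarrow> ('b, 'n) chart set \<Rightarrow> ('a \<Rightarrow> 'b) \<Rightarrow> bool"
  where "smooth_map A A' F \<longleftrightarrow>
    (\<forall>c\<in>A. \<forall>c'\<in>A'. smooth_on (snd c ` {p \<in> fst c. F p \<in> fst c'})
       (\<lambda>x. snd c' (F (inv_into (fst c) (snd c) x))))"

definition diffeomorphism ::
  "'a topology \<Rightarrow> ('a, 'n::finite) chart set \<Rightarrow> 'b topology \<Rightarrow> ('b, 'n) chart set \<Rightarrow> ('a \<Rightarrow> 'b) \<Rightarrow> bool"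
  where "diffeomorphism X A X' A' F \<longleftrightarrow>
    homeomorphic_map X X' F \<and> smooth_map A A' F \<and> smooth_map A' A (inv_into (topspace X) F)"

text \<open>Charts \<open>c\<close> of the source and \<open>c'\<close> of the target give coordinates common to both spaces
  with respect to \<open>F\<close> if corresponding points have the same coordinates.\<close>

definition common_coords ::
  "('a \<Rightarrow> 'b) \<Rightarrow> ('a, 'n::finite) chart \<Rightarrow> ('b, 'n) chart \<Rightarrow> bool"
  where "common_coords F c c' \<longleftrightarrow> F ` fst c = fst c' \<and> (\<forall>p\<in>fst c. snd c' (F p) = snd c p)"


section \<open>Geometrical objects, tensors and affine connections\<close>

text \<open>A geometrical object is given by its components in every chart, at every point of the
  chart domain; the upper index comes first.  Only the classes below are subject to a specific
  transformation law.\<close>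

type_synonym ('a, 'n) obj01 = "('a, 'n) chart \<Rightarrow> 'a \<Rightarrow> 'n \<Rightarrow> real"
type_synonym ('a, 'n) obj11 = "('a, 'n) chart \<Rightarrow> 'a \<Rightarrow> 'n \<Rightarrow> 'n \<Rightarrow> real"
type_synonym ('a, 'n) obj12 = "('a, 'n) chart \<Rightarrow> 'a \<Rightarrow> 'n \<Rightarrow> 'n \<Rightarrow> 'n \<Rightarrow> real"

text \<open>With \<open>x\<close> the coordinates of \<open>c\<close> and \<open>y\<close> those of \<open>d\<close>, \<open>jac c d p i a\<close> is the partial
  derivative of \<open>y^i\<close> by \<open>x^a\<close> at \<open>p\<close>, and \<open>hess c d p i a b\<close> that of \<open>y^i\<close> by \<open>x^a\<close> and \<open>x^b\<close>.\<close>

definition jac :: "('a, 'n::finite) chart \<Rightarrow> ('a, 'n) chart \<Rightarrow> 'a \<Rightarrow> 'n \<Rightarrow> 'n \<Rightarrow> real"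
  where "jac c d p i a = partial_deriv (transition c d) a (snd c p) $ i"

definition hess :: "('a, 'n::finite) chart \<Rightarrow> ('a, 'n) chart \<Rightarrow> 'a \<Rightarrow> 'n \<Rightarrow> 'n \<Rightarrow> 'n \<Rightarrow> real"
  where "hess c d p i a b = partial_deriv (partial_deriv (transition c d) b) a (snd c p) $ i"

definition covariant_vector :: "('a, 'n::finite) chart set \<Rightarrow> ('a, 'n) obj01 \<Rightarrow> bool"
  where "covariant_vector A u \<longleftrightarrow>
    (\<forall>c\<in>A. \<forall>d\<in>A. \<forall>p \<in> fst c \<inter> fst d. \<forall>j. u d p j = (\<Sum>b\<in>UNIV. jac d c p b j * u c p b))"

definition affinor :: "('a, 'n::finite) chart set \<Rightarrow> ('a, 'n) obj11 \<Rightarrow> bool"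
  where "affinor A f \<longleftrightarrow>
    (\<forall>c\<in>A. \<forall>d\<in>A. \<forall>p \<in> fst c \<inter> fst d. \<forall>i j.
       f d p i j = (\<Sum>a\<in>UNIV. \<Sum>b\<in>UNIV. jac c d p i a * jac d c p b j * f c p a b))"

definition tensor12 :: "('a, 'n::finite) chart set \<Rightarrow> ('a, 'n) obj12 \<Rightarrow> bool"
  where "tensor12 A t \<longleftrightarrow>
    (\<forall>c\<in>A. \<forall>d\<in>A. \<forall>p \<in> fst c \<inter> fst d. \<forall>i j k.
       t d p i j k = (\<Sum>a\<in>UNIV. \<Sum>b\<in>UNIV. \<Sum>e\<in>UNIV.
         jac c d p i a * jac d c p b j * jac d c p e k * t c p a b e))"

definition affine_connection :: "('a, 'n::finite) chart set \<Rightarrow> ('a, 'n) obj12 \<Rightarrow> bool"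
  where "affine_connection A L \<longleftrightarrow>
    (\<forall>c\<in>A. \<forall>i j k. smooth_on (snd c ` fst c) (\<lambda>x. L c (inv_into (fst c) (snd c) x) i j k)) \<and>
    (\<forall>c\<in>A. \<forall>d\<in>A. \<forall>p \<in> fst c \<inter> fst d. \<forall>i j k.
       L d p i j k = (\<Sum>a\<in>UNIV. \<Sum>b\<in>UNIV. \<Sum>e\<in>UNIV.
           jac c d p i a * jac d c p b j * jac d c p e k * L c p a b e)
         + (\<Sum>a\<in>UNIV. jac c d p i a * hess d c p a j k))"

text \<open>No symmetry in the lower indices of \<open>L\<close> is imposed: the torsion is arbitrary.\<close>

definition affine_connection_space ::
  "'a topology \<Rightarrow> ('a, 'n::finite) chart set \<Rightarrow> ('a, 'n) obj12 \<Rightarrow> bool"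
  where "affine_connection_space X A L \<longleftrightarrow> smooth_manifold X A \<and> affine_connection A L"

definition delta :: "'n \<Rightarrow> 'n \<Rightarrow> real"
  where "delta i j = (if i = j then 1 else 0)"

definition sym_part :: "('a, 'n) obj12 \<Rightarrow> ('a, 'n) obj12"
  where "sym_part L c p i j k = (L c p i j k + L c p i k j) / 2"

definition symmetric12 :: "('a, 'n) chart set \<Rightarrow> ('a, 'n) obj12 \<Rightarrow> bool"
  where "symmetric12 A t \<longleftrightarrow> (\<forall>c\<in>A. \<forall>p\<in>fst c. \<forall>i j k. t c p i j k = t c p i k j)"

definition antisymmetric12 :: "('a, 'n) chart set \<Rightarrow> ('a, 'n) obj12 \<Rightarrow> bool"
  where "antisymmetric12 A t \<longleftrightarrow> (\<forall>c\<in>A. \<forall>p\<in>fst c. \<forall>i j k. t c p i j k = - t c p i k j)"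


section \<open>Invariants of the Thomas type\<close>

definition invariant_for ::
  "('a, 'n::finite) chart set \<Rightarrow> ('b, 'n) chart set \<Rightarrow> ('a \<Rightarrow> 'b) \<Rightarrow>
    ('a, 'n) obj12 \<Rightarrow> ('b, 'n) obj12 \<Rightarrow> bool"
  where "invariant_for A A' F T T' \<longleftrightarrow>
    (\<forall>c\<in>A. \<forall>c'\<in>A'. common_coords F c c' \<longrightarrow>
       (\<forall>p\<in>fst c. \<forall>i j k. T' c' (F p) i j k = T c p i j k))"

text \<open>\<open>T\<close> (with barred counterpart \<open>T'\<close>) is the basic associated invariant of the Thomas type
  for \<open>F\<close> arising from the representation of the symmetric part of the deformation tensor
  by \<open>\<omega>\<close> and its barred counterpart \<open>\<omega>'\<close>.\<close>

definition basic_thomas_invariant ::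
  "('a, 'n::finite) chart set \<Rightarrow> ('b, 'n) chart set \<Rightarrow> ('a \<Rightarrow> 'b) \<Rightarrow>
    ('a, 'n) obj12 \<Rightarrow> ('b, 'n) obj12 \<Rightarrow> ('a, 'n) obj12 \<Rightarrow> ('b, 'n) obj12 \<Rightarrow>
    ('a, 'n) obj12 \<Rightarrow> ('b, 'n) obj12 \<Rightarrow> bool"
  where "basic_thomas_invariant A A' F L L' \<omega> \<omega>' T T' \<longleftrightarrow>
    (\<forall>c\<in>A. \<forall>c'\<in>A'. common_coords F c c' \<longrightarrow>
       (\<forall>p\<in>fst c. \<forall>i j k.
          sym_part L' c' (F p) i j k - sym_part L c p i j k = \<omega>' c' (F p) i j k - \<omega> c p i j k)) \<and>
    (\<forall>c\<in>A. \<forall>p\<in>fst c. \<forall>i j k. T c p i j k = sym_part L c p i j k - \<omega> c p i j k) \<and>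
    (\<forall>c'\<in>A'. \<forall>q\<in>fst c'. \<forall>i j k. T' c' q i j k = sym_part L' c' q i j k - \<omega>' c' q i j k) \<and>
    invariant_for A A' F T T'"

text \<open>The bracket \<open>[\<dots>]\<close> with free index \<open>k\<close> occurring in the formulas below.\<close>

definition thomas_trace ::
  "real \<Rightarrow> real \<Rightarrow> ('a, 'n::finite) obj12 \<Rightarrow> ('a, 'n) obj11 \<Rightarrow> ('a, 'n) obj01 \<Rightarrow> ('a, 'n) obj12 \<Rightarrow>
    ('a, 'n) obj01"
  where "thomas_trace s\<^sub>2 s\<^sub>3 L f \<sigma> \<phi> c p k =
    (\<Sum>\<alpha>\<in>UNIV. sym_part L c p \<alpha> k \<alpha>)
    - s\<^sub>2 * ((\<Sum>\<alpha>\<in>UNIV. f c p \<alpha> k * \<sigma> c p \<alpha>) + (\<Sum>\<alpha>\<in>UNIV. f c p \<alpha> \<alpha>) * \<sigma> c p k)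
    - s\<^sub>3 * (\<Sum>\<alpha>\<in>UNIV. \<phi> c p \<alpha> k \<alpha>)"

definition thomas_omega ::
  "real \<Rightarrow> real \<Rightarrow> ('a, 'n::finite) obj12 \<Rightarrow> ('a, 'n) obj11 \<Rightarrow> ('a, 'n) obj01 \<Rightarrow> ('a, 'n) obj12 \<Rightarrow>
    ('a, 'n) obj12"
  where "thomas_omega s\<^sub>2 s\<^sub>3 L f \<sigma> \<phi> c p i j k =
    s\<^sub>2 * (f c p i j * \<sigma> c p k + f c p i k * \<sigma> c p j) + s\<^sub>3 * \<phi> c p i j k
    + 1 / (real CARD('n) + 1) * delta i j * thomas_trace s\<^sub>2 s\<^sub>3 L f \<sigma> \<phi> c p k
    + 1 / (real CARD('n) + 1) * delta i k * thomas_trace s\<^sub>2 s\<^sub>3 L f \<sigma> \<phi> c p j"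

definition thomas_T ::
  "real \<Rightarrow> real \<Rightarrow> ('a, 'n::finite) obj12 \<Rightarrow> ('a, 'n) obj11 \<Rightarrow> ('a, 'n) obj01 \<Rightarrow> ('a, 'n) obj12 \<Rightarrow>
    ('a, 'n) obj12"
  where "thomas_T s\<^sub>2 s\<^sub>3 L f \<sigma> \<phi> c p i j k =
    sym_part L c p i j k
    - s\<^sub>2 * (f c p i j * \<sigma> c p k + f c p i k * \<sigma> c p j) - s\<^sub>3 * \<phi> c p i j k
    - 1 / (real CARD('n) + 1) *
        (delta i j * thomas_trace s\<^sub>2 s\<^sub>3 L f \<sigma> \<phi> c p k + delta i k * thomas_trace s\<^sub>2 s\<^sub>3 L f \<sigma> \<phi> c p j)"

end

theory Submission
  imports Defs
begin

text \<open>Symmetrizing the transformation rule in \<open>j\<close>, \<open>k\<close> removes \<open>\<xi>\<close>; contracting \<open>i\<close> with \<open>k\<close>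
  turns the \<open>u\<close>-terms into \<open>(N + 1) s\<^sub>1 (u' - u)\<close>, so that \<open>s\<^sub>1 (u' - u)\<close> is the difference of the
  barred and unbarred brackets divided by \<open>N + 1\<close>.  Substituting this back expresses the symmetric
  part of the deformation tensor as \<open>\<omega>' - \<omega>\<close>.\<close>

lemma sum_delta_trace: "(\<Sum>\<alpha>\<in>UNIV. delta (\<alpha>::'n::finite) \<alpha>) = real CARD('n)"
  by (simp add: delta_def)

lemma sum_delta_mult: "(\<Sum>\<alpha>\<in>UNIV. delta \<alpha> k * v \<alpha>) = v (k::'n::finite)"
proof -
  have "delta \<alpha> k * v \<alpha> = (if \<alpha> = k then v \<alpha> else 0)" for \<alpha>
    by (simp add: delta_def)
  then show ?thesis by simp
qed

text \<open>Reduces invariance of \<open>thomas_T\<close> to the representation of the symmetric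
  deformation by \<open>thomas_omega\<close>: the two formulas differ only in how the factor 1/(N +
  1) is distributed.\<close>

lemma thomas_T_eq:
  "thomas_T s\<^sub>2 s\<^sub>3 L f \<sigma> \<phi> c p i j k = sym_part L c p i j k - thomas_omega s\<^sub>2 s\<^sub>3 L f \<sigma> \<phi> c p i j k"
  by (simp add: thomas_T_def thomas_omega_def algebra_simps)

text \<open>Everything here is algebra at one pair of points in fixed charts: \<open>q\<close>
  stands for the image of \<open>p\<close>, and \<open>w\<close> for the covector s1 (u' - u), about
  which nothing else is assumed.\<close>

context
  fixes c :: "('a, 'n::finite) chart" and c' :: "('b, 'n) chart" and p :: 'a and q :: 'b
    and L \<phi> :: "('a, 'n) obj12" and L' \<phi>' :: "('b, 'n) obj12"
    and f :: "('a, 'n) obj11" and f' :: "('b, 'n) obj11"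
    and \<sigma> :: "('a, 'n) obj01" and \<sigma>' :: "('b, 'n) obj01"
    and w :: "'n \<Rightarrow> real" and s\<^sub>2 s\<^sub>3 :: real
  assumes sym_deformation: "\<And>i j k. sym_part L' c' q i j k - sym_part L c p i j k =
      delta i j * w k + delta i k * w j
      + s\<^sub>2 * ((f' c' q i j * \<sigma>' c' q k + f' c' q i k * \<sigma>' c' q j)
             - (f c p i j * \<sigma> c p k + f c p i k * \<sigma> c p j))
      + s\<^sub>3 * (\<phi>' c' q i j k - \<phi> c p i j k)"
begin

text \<open>The \<open>s\<^sub>2\<close> and \<open>s\<^sub>3\<close> terms of the bracket are the
  contractions of the corresponding terms of the deformation, so they cancel. What remains is
  \<open>w k\<close> from \<open>delta \<alpha> k * w \<alpha>\<close> and N times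
  \<open>w k\<close> from the trace of \<open>delta\<close>.\<close>

lemma thomas_trace_diff:
  "thomas_trace s\<^sub>2 s\<^sub>3 L' f' \<sigma>' \<phi>' c' q k - thomas_trace s\<^sub>2 s\<^sub>3 L f \<sigma> \<phi> c p k
    = (real CARD('n) + 1) * w k"
proof -
  have "(\<Sum>\<alpha>\<in>UNIV. sym_part L' c' q \<alpha> k \<alpha>) - (\<Sum>\<alpha>\<in>UNIV. sym_part L c p \<alpha> k \<alpha>)
      = (\<Sum>\<alpha>\<in>UNIV. delta \<alpha> k * w \<alpha> + delta \<alpha> \<alpha> * w k
          + s\<^sub>2 * ((f' c' q \<alpha> k * \<sigma>' c' q \<alpha> + f' c' q \<alpha> \<alpha> * \<sigma>' c' q k)
                 - (f c p \<alpha> k * \<sigma> c p \<alpha> + f c p \<alpha> \<alpha> * \<sigma> c p k))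
          + s\<^sub>3 * (\<phi>' c' q \<alpha> k \<alpha> - \<phi> c p \<alpha> k \<alpha>))"
    unfolding sum_subtractf[symmetric] sym_deformation by simp
  also have "\<dots> = w k + real CARD('n) * w k
      + s\<^sub>2 * (((\<Sum>\<alpha>\<in>UNIV. f' c' q \<alpha> k * \<sigma>' c' q \<alpha>) + (\<Sum>\<alpha>\<in>UNIV. f' c' q \<alpha> \<alpha>) * \<sigma>' c' q k)
             - ((\<Sum>\<alpha>\<in>UNIV. f c p \<alpha> k * \<sigma> c p \<alpha>) + (\<Sum>\<alpha>\<in>UNIV. f c p \<alpha> \<alpha>) * \<sigma> c p k))
      + s\<^sub>3 * ((\<Sum>\<alpha>\<in>UNIV. \<phi>' c' q \<alpha> k \<alpha>) - (\<Sum>\<alpha>\<in>UNIV. \<phi> c p \<alpha> k \<alpha>))"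
    by (simp only: sum.distrib sum_subtractf sum_delta_mult sum_delta_trace
        sum_distrib_left[symmetric] sum_distrib_right[symmetric])
  finally show ?thesis
    by (simp add: thomas_trace_def algebra_simps)
qed

lemma sym_deformation_eq_thomas_omega_diff:
  "sym_part L' c' q i j k - sym_part L c p i j k
    = thomas_omega s\<^sub>2 s\<^sub>3 L' f' \<sigma>' \<phi>' c' q i j k - thomas_omega s\<^sub>2 s\<^sub>3 L f \<sigma> \<phi> c p i j k"
proof -
  define N where "N = real CARD('n) + 1"
  have "N \<noteq> 0"
    unfolding N_def by linarith
  have trace': "thomas_trace s\<^sub>2 s\<^sub>3 L' f' \<sigma>' \<phi>' c' q m = thomas_trace s\<^sub>2 s\<^sub>3 L f \<sigma> \<phi> c p m + N * w m"
    for m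
    using thomas_trace_diff[of m] by (simp add: N_def)
  \<comment> \<open>Cancellation of \<open>N\<close> in the shape in which the barred bracket enters
    \<omega>': \<open>d\<close> is the Kronecker delta, \<open>t\<close> the unbarred bracket,
    \<open>v\<close> a component of \<open>w\<close>.\<close>
  have "1 / N * d * (t + N * v) = 1 / N * d * t + d * v" for d t v
    using \<open>N \<noteq> 0\<close> by (simp add: field_simps)
  then show ?thesis
    unfolding sym_deformation thomas_omega_def N_def[symmetric] trace' by (simp add: algebra_simps)
qed

end

theorem lemma3p1:
  fixes X :: "'a topology" and A :: "('a, 'n::finite) chart set"
    and X' :: "'b topology" and A' :: "('b, 'n) chart set"
    and F :: "'a \<Rightarrow> 'b"
    and L \<phi> \<xi> :: "('a, 'n) obj12" and L' \<phi>' :: "('b, 'n) obj12"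
    and u \<sigma> :: "('a, 'n) obj01" and u' \<sigma>' :: "('b, 'n) obj01"
    and f :: "('a, 'n) obj11" and f' :: "('b, 'n) obj11"
    and s\<^sub>1 s\<^sub>2 s\<^sub>3 :: real
  assumes "affine_connection_space X A L" and "affine_connection_space X' A' L'"
    and "diffeomorphism X A X' A' F"
    and "s\<^sub>1 \<in> {0, 1}" and "s\<^sub>2 \<in> {0, 1}" and "s\<^sub>3 \<in> {0, 1}"
    and "tensor12 A \<xi>" and "antisymmetric12 A \<xi>"
    and "covariant_vector A u" and "covariant_vector A' u'"
    and "covariant_vector A \<sigma>" and "covariant_vector A' \<sigma>'"
    and "affinor A f" and "affinor A' f'"
    and "symmetric12 A \<phi>" and "symmetric12 A' \<phi>'"
    and transformation: "\<And>c c' p i j k. c \<in> A \<Longrightarrow> c' \<in> A' \<Longrightarrow> common_coords F c c' \<Longrightarrow> p \<in> fst c \<Longrightarrow>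
      L' c' (F p) i j k = L c p i j k
        + s\<^sub>1 * (delta i j * (u' c' (F p) k - u c p k) + delta i k * (u' c' (F p) j - u c p j))
        + s\<^sub>2 * ((f' c' (F p) i j * \<sigma>' c' (F p) k + f' c' (F p) i k * \<sigma>' c' (F p) j)
               - (f c p i j * \<sigma> c p k + f c p i k * \<sigma> c p j))
        + s\<^sub>3 * (\<phi>' c' (F p) i j k - \<phi> c p i j k)
        + \<xi> c p i j k"
  shows "basic_thomas_invariant A A' F L L'
           (thomas_omega s\<^sub>2 s\<^sub>3 L f \<sigma> \<phi>) (thomas_omega s\<^sub>2 s\<^sub>3 L' f' \<sigma>' \<phi>')
           (thomas_T s\<^sub>2 s\<^sub>3 L f \<sigma> \<phi>) (thomas_T s\<^sub>2 s\<^sub>3 L' f' \<sigma>' \<phi>') \<and>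
         (\<forall>c\<in>A. \<forall>c'\<in>A'. common_coords F c c' \<longrightarrow>
           (\<forall>p\<in>fst c. \<forall>i j k.
             thomas_T s\<^sub>2 s\<^sub>3 L' f' \<sigma>' \<phi>' c' (F p) i j k = thomas_T s\<^sub>2 s\<^sub>3 L f \<sigma> \<phi> c p i j k))"
proof -
  let ?\<omega> = "thomas_omega s\<^sub>2 s\<^sub>3 L f \<sigma> \<phi>" and ?\<omega>' = "thomas_omega s\<^sub>2 s\<^sub>3 L' f' \<sigma>' \<phi>'"
  have deformation: "sym_part L' c' (F p) i j k - sym_part L c p i j k = ?\<omega>' c' (F p) i j k - ?\<omega> c p i j k"
    if "c \<in> A" "c' \<in> A'" "common_coords F c c'" "p \<in> fst c" for c c' p i j k
  \<comment> \<open>The factor \<open>s\<^sub>1\<close> is absorbed into \<open>w\<close>, so both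
    of its values are handled at once.\<close>
  proof (rule sym_deformation_eq_thomas_omega_diff[where w = "\<lambda>m. s\<^sub>1 * (u' c' (F p) m - u c p m)"])
    fix i j k
    \<comment> \<open>Symmetry of \<phi>' is given only on chart domains of the target.\<close>
    have "F p \<in> fst c'"
      using that by (auto simp: common_coords_def)
    then have \<phi>': "\<phi>' c' (F p) i k j = \<phi>' c' (F p) i j k"
      using \<open>symmetric12 A' \<phi>'\<close> that unfolding symmetric12_def by blast
    have \<phi>: "\<phi> c p i k j = \<phi> c p i j k"
      using \<open>symmetric12 A \<phi>\<close> that unfolding symmetric12_def by blast
    have \<xi>: "\<xi> c p i k j = - \<xi> c p i j k"
      using \<open>antisymmetric12 A \<xi>\<close> that unfolding antisymmetric12_def by blast
    show "sym_part L' c' (F p) i j k - sym_part L c p i j k =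
        delta i j * (s\<^sub>1 * (u' c' (F p) k - u c p k)) + delta i k * (s\<^sub>1 * (u' c' (F p) j - u c p j))
        + s\<^sub>2 * ((f' c' (F p) i j * \<sigma>' c' (F p) k + f' c' (F p) i k * \<sigma>' c' (F p) j)
               - (f c p i j * \<sigma> c p k + f c p i k * \<sigma> c p j))
        + s\<^sub>3 * (\<phi>' c' (F p) i j k - \<phi> c p i j k)"
      \<comment> \<open>Half the sum of the rule for \<open>j k\<close> and for \<open>k j\<close>:
        the \<xi> terms cancel, and all other added terms are already symmetric.\<close>
      unfolding sym_part_def transformation[OF that, of i j k] transformation[OF that, of i k j] \<phi> \<phi>' \<xi>
      by (simp add: field_simps)
  qed
  \<comment> \<open>Moving the barred terms of the deformation identity to one side gives invariance
    of the symmetric part minus \<omega>.\<close>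
  then have "thomas_T s\<^sub>2 s\<^sub>3 L' f' \<sigma>' \<phi>' c' (F p) i j k = thomas_T s\<^sub>2 s\<^sub>3 L f \<sigma> \<phi> c p i j k"
    if "c \<in> A" "c' \<in> A'" "common_coords F c c'" "p \<in> fst c" for c c' p i j k
    using that by (fastforce simp: thomas_T_eq algebra_simps)
  with deformation show ?thesis
    by (simp add: basic_thomas_invariant_def invariant_for_def thomas_T_eq)
qed

end
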